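(* Let $(b,c)$ be a connected graph over the countably infinite set $X$. Then the following statements are equivalent: (i) The graph $(b,c)$ is uniformly transient. (ii) The diameter of $(X,\gamma_o)$ is finite for one (equivalently, for all) $o\in X$. (iii) The diameter of $(X,\gamma)$ is finite.
   Context: $X$ is a countably infinite set, $C(X)$ the real-valued functions on $X$, $C_c(X)$ those with finite support, $\|f\|_\infty=\sup_X|f|$, and $C_0(X)$ is the closure of $C_c(X)$ with respect to $\|\cdot\|_\infty$. A graph $(b,c)$ over $X$ consists of a symmetric $b:X\times X\to[0,\infty)$ with zero diagonal and $\sum_{y}b(x,y)<\infty$ for all $x$, and an arbitrary $c:X\to[0,\infty)$. It is connected if for any two distinct $x,y\in X$ there are $x=x_0,\dots,x_n=y$ with $b(x_{i-1},x_i)>0$ for $i=1,\dots,n$. For $f\in C(X)$ put $\widetilde Q(f)=\frac12\sum_{x,y}b(x,y)|f(x)-f(y)|^2+\sum_x c(x)|f(x)|^2\in[0,\infty]$ and $\widetilde D=\{f\in C(X):\widetilde Q(f)<\infty\}$. For $o\in X$ put $\|f\|_o=(\widetilde Q(f)+|f(o)|^2)^{1/2}$; for connected graphs these are equivalent norms on $\widetilde D$ for different $o$. $\widetilde D_0$ is the closure of $C_c(X)$ in $\widetilde D$ with respect to $\|\cdot\|_o$ (independent of $o$). A connected graph is uniformly transient if $\widetilde D_0\subseteq C_0(X)$; equivalently, there is $C\ge0$ with $\|\varphi\|_\infty\le C\widetilde Q^{1/2}(\varphi)$ for all $\varphi\in C_c(X)$. For $x,y\in X$ put $\gamma_o(x,y)=\sup\{|\varphi(x)-\varphi(y)|:\varphi\in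 C_c(X),\ \|\varphi\|_o\le1\}$ and $\gamma(x,y)=\sup\{|\varphi(x)-\varphi(y)|:\varphi\in C_c(X),\ \widetilde Q(\varphi)\le1\}$; these are metrics on $X$. A metric space has finite diameter if its distances are bounded by some finite constant. *)

theory Defs
  imports "HOL-Analysis.Analysis"
begin

text \<open>
  The vertex set \<open>X\<close> is the universe of a type \<open>'a\<close>, so \<open>C(X)\<close> is the type \<open>'a \<Rightarrow> real\<close>;
  that \<open>X\<close> is countably infinite is a hypothesis on \<open>UNIV :: 'a set\<close>.
\<close>

definition C_c :: "('a \<Rightarrow> real) set" where
  "C_c = {f. finite {x. f x \<noteq> 0}}"

definition sup_norm :: "('a \<Rightarrow> real) \<Rightarrow> ennreal" where
  "sup_norm f = (SUP x. ennreal \<bar>f x\<bar>)"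

definition C_0 :: "('a \<Rightarrow> real) set" where
  "C_0 = {f. \<forall>\<epsilon>>0. \<exists>\<phi>\<in>C_c. sup_norm (\<lambda>x. f x - \<phi> x) < ennreal \<epsilon>}"

locale weighted_graph =
  fixes b :: "'a \<Rightarrow> 'a \<Rightarrow> real" and c :: "'a \<Rightarrow> real"
  assumes b_nonneg: "b x y \<ge> 0"
    and b_sym: "b x y = b y x"
    and b_diag: "b x x = 0"
    and b_summable: "b x summable_on UNIV"
    and c_nonneg: "c x \<ge> 0"

locale connected_weighted_graph = weighted_graph +
  assumes connected:
    "x \<noteq> y \<Longrightarrow> \<exists>(n::nat) p. p 0 = x \<and> p n = y \<and> (\<forall>i\<in>{1..n}. b (p (i - 1)) (p i) > 0)"

definition energy :: "('a \<Rightarrow> 'a \<Rightarrow> real) \<Rightarrow> ('a \<Rightarrow> real) \<Rightarrow> ('a \<Rightarrow> real) \<Rightarrow> ennreal" where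
  "energy b c f =
     1 / 2 * (\<Sum>\<^sub>\<infinity>(x, y)\<in>UNIV. ennreal (b x y * \<bar>f x - f y\<bar>\<^sup>2))
       + (\<Sum>\<^sub>\<infinity>x\<in>UNIV. ennreal (c x * \<bar>f x\<bar>\<^sup>2))"

definition finite_energy :: "('a \<Rightarrow> 'a \<Rightarrow> real) \<Rightarrow> ('a \<Rightarrow> real) \<Rightarrow> ('a \<Rightarrow> real) set" where
  "finite_energy b c = {f. energy b c f < \<infinity>}"

text \<open>
  Meaningful only for functions of finite energy. This suffices below: it is applied only to
  elements of \<^term>\<open>C_c\<close> and to differences of an element of \<^term>\<open>finite_energy b c\<close> and one
  of \<^term>\<open>C_c\<close>, and these have finite energy on every weighted graph.
\<close>

definition point_norm :: "('a \<Rightarrow> 'a \<Rightarrow> real) \<Rightarrow> ('a \<Rightarrow> real) \<Rightarrow> 'a \<Rightarrow> ('a \<Rightarrow> real) \<Rightarrow> real" where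
  "point_norm b c v f = sqrt (enn2real (energy b c f) + \<bar>f v\<bar>\<^sup>2)"

definition finite_energy_0 :: "('a \<Rightarrow> 'a \<Rightarrow> real) \<Rightarrow> ('a \<Rightarrow> real) \<Rightarrow> 'a \<Rightarrow> ('a \<Rightarrow> real) set" where
  "finite_energy_0 b c v =
     {f \<in> finite_energy b c. \<forall>\<epsilon>>0. \<exists>\<phi>\<in>C_c. point_norm b c v (\<lambda>x. f x - \<phi> x) < \<epsilon>}"

text \<open>
  On a connected graph \<^term>\<open>finite_energy_0 b c v\<close> does not depend on the base point \<open>v\<close>, so the
  quantifier over \<open>v\<close> is immaterial.
\<close>

definition uniformly_transient :: "('a \<Rightarrow> 'a \<Rightarrow> real) \<Rightarrow> ('a \<Rightarrow> real) \<Rightarrow> bool" where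
  "uniformly_transient b c \<longleftrightarrow>
     connected_weighted_graph b c \<and> (\<forall>v. finite_energy_0 b c v \<subseteq> C_0)"

text \<open>
  The suprema are of nonempty sets (\<open>\<phi> = 0\<close>) which are bounded when the graph is connected, by the
  Cauchy-Schwarz inequality along a path from \<open>x\<close> to \<open>y\<close>.
\<close>

definition gamma_pt :: "('a \<Rightarrow> 'a \<Rightarrow> real) \<Rightarrow> ('a \<Rightarrow> real) \<Rightarrow> 'a \<Rightarrow> 'a \<Rightarrow> 'a \<Rightarrow> real" where
  "gamma_pt b c v x y = (SUP \<phi>\<in>{\<phi> \<in> C_c. point_norm b c v \<phi> \<le> 1}. \<bar>\<phi> x - \<phi> y\<bar>)"

definition gamma :: "('a \<Rightarrow> 'a \<Rightarrow> real) \<Rightarrow> ('a \<Rightarrow> real) \<Rightarrow> 'a \<Rightarrow> 'a \<Rightarrow> real" where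
  "gamma b c x y = (SUP \<phi>\<in>{\<phi> \<in> C_c. energy b c \<phi> \<le> 1}. \<bar>\<phi> x - \<phi> y\<bar>)"

definition finite_diameter :: "('a \<Rightarrow> 'a \<Rightarrow> real) \<Rightarrow> bool" where
  "finite_diameter d \<longleftrightarrow> (\<exists>K. \<forall>x y. d x y \<le> K)"

end

theory Submission
  imports Defs
begin

text \<open>
  All three conditions amount to a Sobolev-type inequality \<open>\<parallel>\<phi>\<parallel>\<^sub>\<infinity>\<^sup>2 \<le> C Q(\<phi>)\<close> on \<open>C\<^sub>c(X)\<close>: a finitely
  supported function vanishes somewhere, so bounding its oscillation bounds its values. The same
  inequality with the norm based at a point \<open>o\<close> is no weaker. Otherwise there are finitely supported
  \<open>\<psi>\<close> with \<open>\<psi>(o) = 1\<close> and energy tending to \<open>0\<close>; these would be uniformly Cauchy and converge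
  pointwise to \<open>1\<close>, which is impossible for finitely supported functions.
  If the inequality holds, approximation in energy is uniform approximation. If it fails, a sum of
  nonnegative bumps whose energies decrease geometrically and whose peaks, of height \<open>1\<close>, leave every
  finite set is a limit of finitely supported functions in energy that does not vanish at infinity.
\<close>

section \<open>Finitely supported functions\<close>

lemma C_c_zero: "(\<lambda>x. 0) \<in> C_c"
  by (simp add: C_c_def)

lemma C_c_comp:
  assumes "\<phi> \<in> C_c" and "h 0 = 0"
  shows "(\<lambda>x. h (\<phi> x)) \<in> C_c"
  using assms unfolding C_c_def by (auto elim!: rev_finite_subset)

lemma C_c_add:
  assumes "\<phi> \<in> C_c" and "\<psi> \<in> C_c"
  shows "(\<lambda>x. \<phi> x + \<psi> x) \<in> C_c"
proof -
  have "{x. \<phi> x + \<psi> x \<noteq> 0} \<subseteq> {x. \<phi> x \<noteq> 0} \<union> {x. \<psi> x \<noteq> 0}"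
    by auto
  with assms show ?thesis
    unfolding C_c_def using finite_subset by fastforce
qed

lemma C_c_diff:
  assumes "\<phi> \<in> C_c" and "\<psi> \<in> C_c"
  shows "(\<lambda>x. \<phi> x - \<psi> x) \<in> C_c"
  using C_c_add[OF assms(1) C_c_comp[OF assms(2), of uminus]] by simp

lemma C_c_sum:
  assumes "\<And>k. k \<in> I \<Longrightarrow> \<phi> k \<in> C_c"
  shows "(\<lambda>x. \<Sum>k\<in>I. \<phi> k x) \<in> C_c"
  using assms
  by (induction I rule: infinite_finite_induct) (auto intro: C_c_zero C_c_add)

lemma C_c_vanishes_somewhere:
  fixes \<phi> :: "'a \<Rightarrow> real"
  assumes "infinite (UNIV :: 'a set)" and "\<phi> \<in> C_c"
  obtains y where "\<phi> y = 0"
proof -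
  have "{x. \<phi> x \<noteq> 0} \<noteq> UNIV"
    using assms unfolding C_c_def by (metis mem_Collect_eq)
  then show ?thesis
    using that by auto
qed

section \<open>Energy as a supremum of finite sums\<close>

text \<open>A real finite sum: estimates proved termwise for it transfer to the
  \<open>ennreal\<close>-valued energy. The same \<open>A\<close> indexes the edge sum and the
  killing sum.\<close>

definition local_energy ::
    "('a \<Rightarrow> 'a \<Rightarrow> real) \<Rightarrow> ('a \<Rightarrow> real) \<Rightarrow> 'a set \<Rightarrow> ('a \<Rightarrow> real) \<Rightarrow> real" where
  "local_energy b c A f =
     (\<Sum>x\<in>A. \<Sum>y\<in>A. b x y * (f x - f y)\<^sup>2) / 2 + (\<Sum>x\<in>A. c x * (f x)\<^sup>2)"

lemma infsum_ennreal_eq_SUP: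
  fixes f :: "'i \<Rightarrow> ennreal"
  shows "(\<Sum>\<^sub>\<infinity>x\<in>UNIV. f x) = (SUP A\<in>{A. finite A}. sum f A)"
  by (subst nonneg_infsum_complete) auto

text \<open>Squares are cofinal among finite sets of pairs: \<open>F\<close> lies in the square of
  the union of its two projections.\<close>

lemma infsum_pairs_ennreal_eq_SUP:
  fixes f :: "'i \<times> 'i \<Rightarrow> ennreal"
  shows "(\<Sum>\<^sub>\<infinity>z\<in>UNIV. f z) = (SUP A\<in>{A. finite A}. sum f (A \<times> A))"
  unfolding infsum_ennreal_eq_SUP
proof (rule SUP_eq)
  fix F :: "('i \<times> 'i) set"
  assume F: "F \<in> {A. finite A}"
  have "F \<subseteq> (fst ` F \<union> snd ` F) \<times> (fst ` F \<union> snd ` F)"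
    by force
  then show "\<exists>A\<in>{A. finite A}. sum f F \<le> sum f (A \<times> A)"
    using F by (intro bexI[of _ "fst ` F \<union> snd ` F"] sum_mono2) auto
qed auto

context weighted_graph
begin

lemma local_energy_nonneg: "0 \<le> local_energy b c A f"
  unfolding local_energy_def
  by (intro add_nonneg_nonneg divide_nonneg_nonneg sum_nonneg mult_nonneg_nonneg)
    (auto simp: b_nonneg c_nonneg)

text \<open>Both sums are suprema of monotone functions of a finite set, and
  \<open>A \<union> B\<close> dominates \<open>A\<close> and \<open>B\<close>. The family being
  directed, the sum of the suprema is the supremum of the sums.\<close>

lemma energy_eq_SUP:
  "energy b c f = (SUP A\<in>{A. finite A}. ennreal (local_energy b c A f))"
proof -
  define g where "g = (\<lambda>(x, y). ennreal (b x y * \<bar>f x - f y\<bar>\<^sup>2))"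
  define h where "h = (\<lambda>x. ennreal (c x * \<bar>f x\<bar>\<^sup>2))"
  have "energy b c f = (SUP A\<in>{A. finite A}. 1 / 2 * sum g (A \<times> A)) + (SUP A\<in>{A. finite A}. sum h A)"
    unfolding energy_def g_def[symmetric] h_def[symmetric]
    by (simp add: infsum_pairs_ennreal_eq_SUP infsum_ennreal_eq_SUP[of h] SUP_mult_left_ennreal)
  also have "\<dots> = (SUP A\<in>{A. finite A}. 1 / 2 * sum g (A \<times> A) + sum h A)"
  proof (rule SUP_add_directed_ennreal[symmetric])
    fix A B :: "'a set"
    assume "A \<in> {A. finite A}" "B \<in> {A. finite A}"
    then show "\<exists>D\<in>{A. finite A}.
        1 / 2 * sum g (A \<times> A) + sum h B \<le> 1 / 2 * sum g (D \<times> D) + sum h D"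
      by (intro bexI[of _ "A \<union> B"] add_mono mult_left_mono sum_mono2) auto
  qed
  also have "\<dots> = (SUP A\<in>{A. finite A}. ennreal (local_energy b c A f))"
  proof (rule SUP_cong[OF refl])
    fix A :: "'a set"
    assume "A \<in> {A. finite A}"
    have "sum g (A \<times> A) = ennreal (\<Sum>x\<in>A. \<Sum>y\<in>A. b x y * (f x - f y)\<^sup>2)"
      unfolding g_def
      by (simp add: sum.cartesian_product[symmetric] sum_ennreal sum_nonneg b_nonneg)
    moreover have "sum h A = ennreal (\<Sum>x\<in>A. c x * (f x)\<^sup>2)"
      unfolding h_def by (simp add: sum_ennreal c_nonneg)
    moreover have "1 / 2 * ennreal r = ennreal (r / 2)" if "0 \<le> r" for r
    proof -
      have "ennreal (r / 2) = ennreal (1 / 2) * ennreal r"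
        using that ennreal_mult[of "1 / 2" r] by simp
      also have "ennreal (1 / 2) = 1 / 2"
        by (metis divide_ennreal ennreal_1 ennreal_numeral zero_le_one zero_less_numeral zero_le_numeral)
      finally show ?thesis ..
    qed
    ultimately show "1 / 2 * sum g (A \<times> A) + sum h A = ennreal (local_energy b c A f)"
      by (simp add: local_energy_def sum_nonneg b_nonneg c_nonneg)
  qed
  finally show ?thesis .
qed

lemma energy_le_iff:
  assumes "0 \<le> s"
  shows "energy b c f \<le> ennreal s \<longleftrightarrow> (\<forall>A. finite A \<longrightarrow> local_energy b c A f \<le> s)"
  using assms by (auto simp: energy_eq_SUP SUP_le_iff)

section \<open>Energy under algebraic operations, moduli and pointwise limits\<close>

lemma energy_zero: "energy b c (\<lambda>x. 0) = 0"
  using energy_le_iff[of 0 "\<lambda>x. 0"] by (simp add: local_energy_def)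

text \<open>The bound \<open>par\<close> holds since the gap between its two sides is
  \<open>(u + w)\<^sup>2\<close>; it is summed over vertices and edges. This crude form of the
  triangle inequality avoids square roots of energies.\<close>

lemma energy_diff_le:
  assumes "energy b c f \<le> ennreal s" "energy b c g \<le> ennreal t" "0 \<le> s" "0 \<le> t"
  shows "energy b c (\<lambda>x. f x - g x) \<le> ennreal (2 * s + 2 * t)"
proof -
  have par: "(u - w)\<^sup>2 \<le> 2 * u\<^sup>2 + 2 * w\<^sup>2" for u w :: real
    using zero_le_power2[of "u + w"] by (simp add: power2_eq_square algebra_simps)
  have "local_energy b c A (\<lambda>x. f x - g x) \<le> 2 * local_energy b c A f + 2 * local_energy b c A g" for A
  proof -
    have "b x y * (f x - g x - (f y - g y))\<^sup>2
        \<le> 2 * (b x y * (f x - f y)\<^sup>2) + 2 * (b x y * (g x - g y)\<^sup>2)" for x y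
      using mult_left_mono[OF par[of "f x - f y" "g x - g y"] b_nonneg[of x y]]
      by (simp add: algebra_simps)
    moreover have "c x * (f x - g x)\<^sup>2 \<le> 2 * (c x * (f x)\<^sup>2) + 2 * (c x * (g x)\<^sup>2)" for x
      using mult_left_mono[OF par[of "f x" "g x"] c_nonneg[of x]] by (simp add: algebra_simps)
    ultimately have "(\<Sum>x\<in>A. \<Sum>y\<in>A. b x y * (f x - g x - (f y - g y))\<^sup>2)
          \<le> (\<Sum>x\<in>A. \<Sum>y\<in>A. 2 * (b x y * (f x - f y)\<^sup>2) + 2 * (b x y * (g x - g y)\<^sup>2))"
        and "(\<Sum>x\<in>A. c x * (f x - g x)\<^sup>2) \<le> (\<Sum>x\<in>A. 2 * (c x * (f x)\<^sup>2) + 2 * (c x * (g x)\<^sup>2))"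
      by (intro sum_mono; blast)+
    then show ?thesis
      unfolding local_energy_def by (simp add: sum.distrib flip: sum_distrib_left)
  qed
  moreover have "2 * local_energy b c A f + 2 * local_energy b c A g \<le> 2 * s + 2 * t" if "finite A" for A
    using assms that by (simp add: energy_le_iff add_mono)
  ultimately have "\<forall>A. finite A \<longrightarrow> local_energy b c A (\<lambda>x. f x - g x) \<le> 2 * s + 2 * t"
    by (meson order_trans)
  then show ?thesis
    using assms by (subst energy_le_iff) simp_all
qed

lemma energy_uminus: "energy b c (\<lambda>x. - f x) = energy b c f"
  by (simp add: energy_eq_SUP local_energy_def power2_commute)

lemma energy_add_le:
  assumes "energy b c f \<le> ennreal s" "energy b c g \<le> ennreal t" "0 \<le> s" "0 \<le> t"
  shows "energy b c (\<lambda>x. f x + g x) \<le> ennreal (2 * s + 2 * t)"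
  using energy_diff_le[of f s "\<lambda>x. - g x" t] assms by (simp add: energy_uminus)

lemma energy_scale_le:
  assumes "energy b c f \<le> ennreal s" "0 \<le> s"
  shows "energy b c (\<lambda>x. t * f x) \<le> ennreal (t\<^sup>2 * s)"
proof -
  have "local_energy b c A (\<lambda>x. t * f x) = t\<^sup>2 * local_energy b c A f" for A
  proof -
    have "b x y * (t * f x - t * f y)\<^sup>2 = t\<^sup>2 * (b x y * (f x - f y)\<^sup>2)" for x y
      by (simp add: power2_eq_square algebra_simps)
    moreover have "c x * (t * f x)\<^sup>2 = t\<^sup>2 * (c x * (f x)\<^sup>2)" for x
      by (simp add: power2_eq_square algebra_simps)
    ultimately show ?thesis
      unfolding local_energy_def by (simp only: flip: sum_distrib_left) (simp add: algebra_simps)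
  qed
  then show ?thesis
    using assms by (simp add: energy_le_iff mult_left_mono)
qed

text \<open>The modulus is a contraction fixing 0, so no term increases. This is what later makes
  the bumps nonnegative.\<close>

lemma energy_abs_le:
  assumes "energy b c f \<le> ennreal s" "0 \<le> s"
  shows "energy b c (\<lambda>x. \<bar>f x\<bar>) \<le> ennreal s"
proof -
  have "(\<bar>u\<bar> - \<bar>w\<bar>)\<^sup>2 \<le> (u - w)\<^sup>2" for u w :: real
    by (metis abs_ge_zero abs_triangle_ineq3 power2_abs power_mono)
  then have "local_energy b c A (\<lambda>x. \<bar>f x\<bar>) \<le> local_energy b c A f" for A
    unfolding local_energy_def
    by (intro add_mono divide_right_mono sum_mono mult_left_mono b_nonneg c_nonneg) auto
  then show ?thesis
    unfolding energy_le_iff[OF assms(2)] using assms by (meson energy_le_iff order_trans)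
qed

text \<open>Each local energy involves finitely many values and is continuous under pointwise
  convergence; a supremum of such functionals is lower semicontinuous.\<close>

lemma energy_lower_semicontinuous:
  assumes "\<And>x. (\<lambda>n. g n x) \<longlonglongrightarrow> f x"
    and "\<And>n :: nat. energy b c (g n) \<le> ennreal s" and "0 \<le> s"
  shows "energy b c f \<le> ennreal s"
  unfolding energy_le_iff[OF assms(3)]
proof (intro allI impI)
  fix A :: "'a set"
  assume "finite A"
  have "(\<lambda>n. local_energy b c A (g n)) \<longlonglongrightarrow> local_energy b c A f"
    unfolding local_energy_def by (intro tendsto_intros assms(1)) auto
  then show "local_energy b c A f \<le> s"
    using assms(2) \<open>finite A\<close>
    by (intro LIMSEQ_le_const2) (auto simp: energy_le_iff[OF assms(3)])
qed

lemma C_c_finite_energy: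
  assumes "\<phi> \<in> C_c"
  shows "energy b c \<phi> < \<infinity>"
proof -
  define S where "S = {x. \<phi> x \<noteq> 0}"
  have S: "finite S"
    using assms by (simp add: S_def C_c_def)
  \<comment> \<open>The factor 2 is half of 4: splitting the square gives twice the sum of
    \<open>(\<phi> x)\<^sup>2\<close> and \<open>(\<phi> y)\<^sup>2\<close>, and by symmetry of
    \<open>b\<close> the two resulting double sums agree.\<close>
  define s where "s = (\<Sum>x\<in>S. (2 * infsum (b x) UNIV + c x) * (\<phi> x)\<^sup>2)"
  have deg: "(\<Sum>y\<in>A. b x y) \<le> infsum (b x) UNIV" if "finite A" for A x
    using that by (intro finite_sum_le_infsum b_summable) (auto simp: b_nonneg)
  have "local_energy b c A \<phi> \<le> s" if A: "finite A" for A
  proof -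
    have "b x y * (\<phi> x - \<phi> y)\<^sup>2 \<le> 2 * (b x y * (\<phi> x)\<^sup>2) + 2 * (b x y * (\<phi> y)\<^sup>2)" for x y
    proof -
      have "(\<phi> x - \<phi> y)\<^sup>2 \<le> 2 * (\<phi> x)\<^sup>2 + 2 * (\<phi> y)\<^sup>2"
        using zero_le_power2[of "\<phi> x + \<phi> y"] by (simp add: power2_eq_square algebra_simps)
      from mult_left_mono[OF this b_nonneg[of x y]] show ?thesis
        by (simp add: algebra_simps)
    qed
    then have "(\<Sum>x\<in>A. \<Sum>y\<in>A. b x y * (\<phi> x - \<phi> y)\<^sup>2)
        \<le> (\<Sum>x\<in>A. \<Sum>y\<in>A. 2 * (b x y * (\<phi> x)\<^sup>2) + 2 * (b x y * (\<phi> y)\<^sup>2))"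
      by (intro sum_mono) blast
    also have "\<dots> = 2 * (\<Sum>x\<in>A. \<Sum>y\<in>A. b x y * (\<phi> x)\<^sup>2) + 2 * (\<Sum>x\<in>A. \<Sum>y\<in>A. b x y * (\<phi> y)\<^sup>2)"
      by (simp add: sum.distrib flip: sum_distrib_left)
    also have "(\<Sum>x\<in>A. \<Sum>y\<in>A. b x y * (\<phi> y)\<^sup>2) = (\<Sum>x\<in>A. \<Sum>y\<in>A. b x y * (\<phi> x)\<^sup>2)"
      by (subst sum.swap) (simp add: b_sym)
    finally have "local_energy b c A \<phi>
        \<le> 2 * (\<Sum>x\<in>A. \<Sum>y\<in>A. b x y * (\<phi> x)\<^sup>2) + (\<Sum>x\<in>A. c x * (\<phi> x)\<^sup>2)"
      unfolding local_energy_def by simp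
    also have "\<dots> = (\<Sum>x\<in>A. (2 * (\<Sum>y\<in>A. b x y) + c x) * (\<phi> x)\<^sup>2)"
      by (simp add: sum_distrib_left sum_distrib_right sum.distrib algebra_simps)
    also have "\<dots> \<le> (\<Sum>x\<in>A. (2 * infsum (b x) UNIV + c x) * (\<phi> x)\<^sup>2)"
      using deg[OF A] by (intro sum_mono mult_right_mono) auto
    also have "\<dots> = (\<Sum>x\<in>A \<inter> S. (2 * infsum (b x) UNIV + c x) * (\<phi> x)\<^sup>2)"
      using A by (intro sum.mono_neutral_right) (auto simp: S_def)
    also have "\<dots> \<le> s"
      unfolding s_def using S
      by (intro sum_mono2 mult_nonneg_nonneg add_nonneg_nonneg)
        (auto simp: c_nonneg b_nonneg intro: infsum_nonneg)
    finally show ?thesis .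
  qed
  moreover have "0 \<le> s"
    using calculation[of "{}"] by (simp add: local_energy_def)
  ultimately have "energy b c \<phi> \<le> ennreal s"
    by (simp add: energy_le_iff)
  then show ?thesis
    using ennreal_less_top order_le_less_trans by (metis infinity_ennreal_def)
qed

lemma finite_energy_diff:
  assumes "energy b c f < \<infinity>" and "energy b c g < \<infinity>"
  shows "energy b c (\<lambda>x. f x - g x) < \<infinity>"
proof -
  have "energy b c f \<le> ennreal (enn2real (energy b c f))"
      and "energy b c g \<le> ennreal (enn2real (energy b c g))"
    using assms by simp_all
  from energy_diff_le[OF this] show ?thesis
    by (metis enn2real_nonneg ennreal_less_top infinity_ennreal_def order_le_less_trans)
qed

section \<open>Adding a unit of killing at a vertex\<close>

text \<open>
  Raising \<open>c\<close> by one at \<open>v\<close> turns the energy into the square of the norm with base point \<open>v\<close>, so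
  that \<^term>\<open>gamma_pt\<close> becomes an instance of \<^term>\<open>gamma\<close>.
\<close>

lemma weighted_graph_killed: "weighted_graph b (c(v := c v + 1))"
  by unfold_locales (auto simp: b_nonneg b_sym b_diag b_summable c_nonneg add_nonneg_nonneg)

lemma energy_killed: "energy b (c(v := c v + 1)) f = energy b c f + ennreal ((f v)\<^sup>2)"
proof -
  have "(\<Sum>\<^sub>\<infinity>x. ennreal ((c(v := c v + 1)) x * \<bar>f x\<bar>\<^sup>2))
      = (\<Sum>\<^sub>\<infinity>x. ennreal (c x * \<bar>f x\<bar>\<^sup>2) + (if x = v then ennreal ((f v)\<^sup>2) else 0))"
    by (intro infsum_cong) (auto simp: algebra_simps c_nonneg simp flip: ennreal_plus)
  also have "\<dots> = (\<Sum>\<^sub>\<infinity>x. ennreal (c x * \<bar>f x\<bar>\<^sup>2)) + (\<Sum>\<^sub>\<infinity>x. if x = v then ennreal ((f v)\<^sup>2) else 0)"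
    by (intro infsum_add nonneg_summable_on_complete) auto
  also have "(\<Sum>\<^sub>\<infinity>x. if x = v then ennreal ((f v)\<^sup>2) else 0) = (\<Sum>\<^sub>\<infinity>x\<in>{v}. ennreal ((f v)\<^sup>2))"
    by (rule infsum_cong_neutral) auto
  finally show ?thesis
    by (simp add: energy_def add.assoc)
qed

lemma point_norm_eq:
  assumes "energy b c f < \<infinity>"
  shows "point_norm b c v f = sqrt (enn2real (energy b (c(v := c v + 1)) f))"
    and "energy b (c(v := c v + 1)) f < \<infinity>"
  using assms by (auto simp: point_norm_def energy_killed enn2real_plus)

lemma gamma_pt_eq_gamma: "gamma_pt b c v = gamma b (c(v := c v + 1))"
proof -
  have "point_norm b c v \<phi> \<le> 1 \<longleftrightarrow> energy b (c(v := c v + 1)) \<phi> \<le> 1" if "\<phi> \<in> C_c" for \<phi>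
  proof -
    note e = point_norm_eq[OF C_c_finite_energy[OF that], of v]
    have "energy b (c(v := c v + 1)) \<phi> = ennreal (enn2real (energy b (c(v := c v + 1)) \<phi>))"
      using e(2) by simp
    then have "energy b (c(v := c v + 1)) \<phi> \<le> 1 \<longleftrightarrow> enn2real (energy b (c(v := c v + 1)) \<phi>) \<le> 1"
      by (metis enn2real_nonneg ennreal_le_1)
    then show ?thesis
      by (simp add: e(1))
  qed
  then have "{\<phi> \<in> C_c. point_norm b c v \<phi> \<le> 1} = {\<phi> \<in> C_c. energy b (c(v := c v + 1)) \<phi> \<le> 1}"
    by blast
  then show ?thesis
    by (intro ext) (simp add: gamma_pt_def gamma_def)
qed

text \<open>Since \<open>f\<close> and \<phi> have finite energy, so has \<open>f - \<phi>\<close>,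
  and \<open>enn2real\<close> loses nothing. The base point norm can therefore be traded for the
  killed energy, to which all energy estimates apply.\<close>

lemma mem_finite_energy_0_iff:
  "f \<in> finite_energy_0 b c v \<longleftrightarrow> energy b c f < \<infinity> \<and>
     (\<forall>s>0. \<exists>\<phi>\<in>C_c. energy b (c(v := c v + 1)) (\<lambda>x. f x - \<phi> x) \<le> ennreal s)"
proof (cases "energy b c f < \<infinity>")
  case True
  let ?E = "\<lambda>\<phi>. energy b (c(v := c v + 1)) (\<lambda>x. f x - \<phi> x)"
  have e: "point_norm b c v (\<lambda>x. f x - \<phi> x) = sqrt (enn2real (?E \<phi>))"
      "?E \<phi> = ennreal (enn2real (?E \<phi>))" if "\<phi> \<in> C_c" for \<phi>
    using point_norm_eq[OF finite_energy_diff[OF True C_c_finite_energy[OF that]], of v] by auto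
  have "(\<forall>\<epsilon>>0. \<exists>\<phi>\<in>C_c. point_norm b c v (\<lambda>x. f x - \<phi> x) < \<epsilon>) \<longleftrightarrow>
      (\<forall>s>0. \<exists>\<phi>\<in>C_c. ?E \<phi> \<le> ennreal s)"
  proof (intro iffI allI impI)
    fix s :: real
    assume "0 < s" and "\<forall>\<epsilon>>0. \<exists>\<phi>\<in>C_c. point_norm b c v (\<lambda>x. f x - \<phi> x) < \<epsilon>"
    then obtain \<phi> where \<phi>: "\<phi> \<in> C_c" "point_norm b c v (\<lambda>x. f x - \<phi> x) < sqrt s"
      by (meson real_sqrt_gt_zero)
    then have "enn2real (?E \<phi>) \<le> s"
      by (simp add: e(1))
    then have "?E \<phi> \<le> ennreal s"
      by (subst e(2)[OF \<phi>(1)]) (rule ennreal_leI)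
    with \<phi>(1) show "\<exists>\<phi>\<in>C_c. ?E \<phi> \<le> ennreal s"
      by (intro bexI[of _ \<phi>])
  next
    fix \<epsilon> :: real
    assume "0 < \<epsilon>" and "\<forall>s>0. \<exists>\<phi>\<in>C_c. ?E \<phi> \<le> ennreal s"
    \<comment> \<open>Halving \<epsilon> turns the weak bound into the required strict one.\<close>
    then obtain \<phi> where \<phi>: "\<phi> \<in> C_c" "?E \<phi> \<le> ennreal ((\<epsilon> / 2)\<^sup>2)"
      using half_gt_zero[OF \<open>0 < \<epsilon>\<close>] zero_less_power by blast
    then have "enn2real (?E \<phi>) \<le> (\<epsilon> / 2)\<^sup>2"
      by (subst (asm) e(2)[OF \<phi>(1)]) (simp add: ennreal_le_iff)
    then have "sqrt (enn2real (?E \<phi>)) \<le> \<epsilon> / 2"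
      using \<open>0 < \<epsilon>\<close> by (intro real_le_lsqrt) auto
    then show "\<exists>\<phi>\<in>C_c. point_norm b c v (\<lambda>x. f x - \<phi> x) < \<epsilon>"
      using \<phi>(1) \<open>0 < \<epsilon>\<close> by (intro bexI[of _ \<phi>]) (simp_all add: e(1))
  qed
  with True show ?thesis
    by (simp add: finite_energy_0_def finite_energy_def)
qed (simp add: finite_energy_0_def finite_energy_def)

end

section \<open>Pointwise control by the energy\<close>

context connected_weighted_graph
begin

lemma connected_weighted_graph_killed: "connected_weighted_graph b (c(v := c v + 1))"
  using weighted_graph_killed connected
  by (auto simp: connected_weighted_graph_def connected_weighted_graph_axioms_def)

text \<open>In the local energy of \<open>{x, y}\<close> the edge occurs in both orders, which
  cancels the factor 1/2.\<close>

lemma energy_controls_edge: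
  assumes "0 < b x y" and "energy b c f \<le> ennreal s" and "0 \<le> s"
  shows "(f x - f y)\<^sup>2 \<le> 1 / b x y * s"
proof -
  have "x \<noteq> y"
    using assms(1) b_diag by auto
  have "local_energy b c {x, y} f \<le> s"
    using assms(2,3) by (simp add: energy_le_iff)
  moreover have "local_energy b c {x, y} f
      = b x y * (f x - f y)\<^sup>2 + (c x * (f x)\<^sup>2 + c y * (f y)\<^sup>2)"
    using \<open>x \<noteq> y\<close> b_sym[of x y] power2_commute[of "f x" "f y"] by (simp add: local_energy_def)
  moreover have "0 \<le> c x * (f x)\<^sup>2 + c y * (f y)\<^sup>2"
    by (simp add: c_nonneg)
  ultimately have "b x y * (f x - f y)\<^sup>2 \<le> s"
    by linarith
  then show ?thesis
    using assms(1) by (simp add: field_simps)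
qed

text \<open>The constant depends on the path alone and is uniform in \<open>f\<close> and
  \<open>s\<close>. Each further edge doubles it and adds twice the inverse weight of the
  edge.\<close>

lemma energy_controls_path:
  fixes n :: nat
  assumes "\<forall>i\<in>{1..n}. 0 < b (p (i - 1)) (p i)"
  shows "\<exists>K\<ge>0. \<forall>f s. 0 \<le> s \<longrightarrow> energy b c f \<le> ennreal s \<longrightarrow> (f (p 0) - f (p n))\<^sup>2 \<le> K * s"
  using assms
proof (induction n)
  case 0
  then show ?case
    by (intro exI[of _ 0]) simp
next
  case (Suc n)
  then obtain K where K: "0 \<le> K"
      "\<And>f s. 0 \<le> s \<Longrightarrow> energy b c f \<le> ennreal s \<Longrightarrow> (f (p 0) - f (p n))\<^sup>2 \<le> K * s"
    by auto
  have edge: "0 < b (p n) (p (Suc n))"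
    using Suc.prems by (auto dest: bspec[of _ _ "Suc n"])
  have "(f (p 0) - f (p (Suc n)))\<^sup>2 \<le> (2 * K + 2 * (1 / b (p n) (p (Suc n)))) * s"
    if "0 \<le> s" "energy b c f \<le> ennreal s" for f s
  proof -
    have "(u + w)\<^sup>2 \<le> 2 * u\<^sup>2 + 2 * w\<^sup>2" for u w :: real
      using zero_le_power2[of "u - w"] by (simp add: power2_eq_square algebra_simps)
    from this[of "f (p 0) - f (p n)" "f (p n) - f (p (Suc n))"]
    have "(f (p 0) - f (p (Suc n)))\<^sup>2
        \<le> 2 * (f (p 0) - f (p n))\<^sup>2 + 2 * (f (p n) - f (p (Suc n)))\<^sup>2"
      by simp
    also have "\<dots> \<le> 2 * (K * s) + 2 * (1 / b (p n) (p (Suc n)) * s)"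
      using K(2)[OF that] energy_controls_edge[OF edge that(2,1)] by linarith
    finally show ?thesis
      by (simp add: algebra_simps)
  qed
  moreover have "0 \<le> 2 * K + 2 * (1 / b (p n) (p (Suc n)))"
    using K(1) edge by simp
  ultimately show ?case
    by blast
qed

lemma energy_controls_difference:
  obtains K where "0 \<le> K"
    and "\<And>f s. 0 \<le> s \<Longrightarrow> energy b c f \<le> ennreal s \<Longrightarrow> (f x - f y)\<^sup>2 \<le> K * s"
proof (cases "x = y")
  case True
  then show ?thesis
    using that[of 0] by simp
next
  case False
  then obtain n :: nat and p where "p 0 = x" "p n = y" "\<forall>i\<in>{1..n}. 0 < b (p (i - 1)) (p i)"
    using connected by blast
  with energy_controls_path[of n p] that show ?thesis
    by auto
qed

lemma killed_energy_le:
  assumes "energy b (c(v := c v + 1)) f \<le> ennreal s" and "0 \<le> s"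
  shows "energy b c f \<le> ennreal s" and "(f v)\<^sup>2 \<le> s"
proof -
  have "energy b c f \<le> energy b (c(v := c v + 1)) f"
      and "ennreal ((f v)\<^sup>2) \<le> energy b (c(v := c v + 1)) f"
    by (simp_all add: energy_killed)
  then have "energy b c f \<le> ennreal s" and "ennreal ((f v)\<^sup>2) \<le> ennreal s"
    using assms(1) by (blast intro: order_trans)+
  then show "energy b c f \<le> ennreal s" and "(f v)\<^sup>2 \<le> s"
    using assms(2) by simp_all
qed

text \<open>Evaluation at \<open>x\<close> is continuous for the norm based at \<open>v\<close>: go
  from \<open>x\<close> to \<open>v\<close> and use the killing term there. \<open>K\<close> depends
  on \<open>x\<close>; it is taken positive because it serves as a divisor later.\<close>

lemma killed_energy_controls_value:
  obtains K where "0 < K"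
    and "\<And>f s. 0 \<le> s \<Longrightarrow> energy b (c(v := c v + 1)) f \<le> ennreal s \<Longrightarrow> (f x)\<^sup>2 \<le> K * s"
proof -
  obtain K where K: "0 \<le> K"
      "\<And>f s. 0 \<le> s \<Longrightarrow> energy b c f \<le> ennreal s \<Longrightarrow> (f x - f v)\<^sup>2 \<le> K * s"
    using energy_controls_difference by blast
  have "(f x)\<^sup>2 \<le> (2 * K + 2) * s"
    if s: "0 \<le> s" "energy b (c(v := c v + 1)) f \<le> ennreal s" for f s
  proof -
    have "(u + w)\<^sup>2 \<le> 2 * u\<^sup>2 + 2 * w\<^sup>2" for u w :: real
      using zero_le_power2[of "u - w"] by (simp add: power2_eq_square algebra_simps)
    from this[of "f x - f v" "f v"]
    have "(f x)\<^sup>2 \<le> 2 * (f x - f v)\<^sup>2 + 2 * (f v)\<^sup>2"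
      by simp
    also have "\<dots> \<le> 2 * (K * s) + 2 * s"
      using K(2)[OF s(1) killed_energy_le(1)[OF s(2,1)]] killed_energy_le(2)[OF s(2,1)] by linarith
    finally show ?thesis
      by (simp add: algebra_simps)
  qed
  then show ?thesis
    using that[of "2 * K + 2"] K(1) by simp
qed

end

section \<open>The Sobolev-type inequality and the diameter\<close>

text \<open>The Sobolev-type inequality, squared and tested against real upper bounds
  \<open>s\<close> of the energy, so that no \<open>ennreal\<close> is converted. Positive
  \<open>s\<close> suffice: energy 0 is covered by letting \<open>s\<close> tend to 0.\<close>

definition sup_bounded :: "('a \<Rightarrow> 'a \<Rightarrow> real) \<Rightarrow> ('a \<Rightarrow> real) \<Rightarrow> real \<Rightarrow> bool" where
  "sup_bounded b c C \<longleftrightarrow>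
     (\<forall>\<phi>\<in>C_c. \<forall>s>0. \<forall>x. energy b c \<phi> \<le> ennreal s \<longrightarrow> (\<phi> x)\<^sup>2 \<le> C * s)"

lemma sup_boundedD:
  assumes "sup_bounded b c C" "\<phi> \<in> C_c" "0 < s" "energy b c \<phi> \<le> ennreal s"
  shows "(\<phi> x)\<^sup>2 \<le> C * s"
  using assms unfolding sup_bounded_def by blast

lemma sup_bounded_mono:
  assumes "sup_bounded b c C" and "C \<le> D"
  shows "sup_bounded b c D"
  unfolding sup_bounded_def
proof (intro ballI allI impI)
  fix \<phi> :: "'a \<Rightarrow> real" and s :: real and x
  assume "\<phi> \<in> C_c" "0 < s" "energy b c \<phi> \<le> ennreal s"
  then have "(\<phi> x)\<^sup>2 \<le> C * s"
    by (rule sup_boundedD[OF assms(1)])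
  also have "\<dots> \<le> D * s"
    using assms(2) \<open>0 < s\<close> by (simp add: mult_right_mono)
  finally show "(\<phi> x)\<^sup>2 \<le> D * s" .
qed

context connected_weighted_graph
begin

text \<open>Scaled into the unit ball, a finitely supported function vanishes at some
  \<open>y\<close>, so its value at \<open>x\<close> is an oscillation, bounded by the diameter.
  Conversely the oscillation is at most twice the supremum.\<close>

lemma finite_diameter_gamma_iff:
  assumes "infinite (UNIV :: 'a set)"
  shows "finite_diameter (gamma b c) \<longleftrightarrow> (\<exists>C. sup_bounded b c C)"
proof
  assume "finite_diameter (gamma b c)"
  then obtain K where K: "\<And>x y. gamma b c x y \<le> K"
    unfolding finite_diameter_def by blast
  have "(\<phi> x)\<^sup>2 \<le> K\<^sup>2 * s" if \<phi>: "\<phi> \<in> C_c" "0 < s" "energy b c \<phi> \<le> ennreal s" for \<phi> s x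
  proof -
    define \<psi> where "\<psi> = (\<lambda>z. (1 / sqrt s) * \<phi> z)"
    have \<psi>: "\<psi> \<in> {\<phi> \<in> C_c. energy b c \<phi> \<le> 1}"
      using \<phi>(2) energy_scale_le[OF \<phi>(3), of "1 / sqrt s"] C_c_comp[OF \<phi>(1), of "\<lambda>u. (1 / sqrt s) * u"]
      by (simp add: \<psi>_def power_divide)
    obtain y where y: "\<psi> y = 0"
      using C_c_vanishes_somewhere[OF assms \<phi>(1)] by (auto simp: \<psi>_def)
    \<comment> \<open>\<open>L\<close> depends on \<open>x\<close> and \<open>y\<close>; it only
      shows that the real supremum defining \<open>gamma\<close> is over a bounded set. The uniform
      bound is \<open>K\<close>.\<close>
    obtain L where "0 \<le> L"
        and L: "\<And>f s. 0 \<le> s \<Longrightarrow> energy b c f \<le> ennreal s \<Longrightarrow> (f x - f y)\<^sup>2 \<le> L * s"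
      using energy_controls_difference by blast
    have "\<bar>f x - f y\<bar> \<le> sqrt L" if "energy b c f \<le> 1" for f
      using L[of 1 f] that by (intro real_le_rsqrt) simp
    then have "bdd_above ((\<lambda>\<phi>. \<bar>\<phi> x - \<phi> y\<bar>) ` {\<phi> \<in> C_c. energy b c \<phi> \<le> 1})"
      by (intro bdd_aboveI[of _ "sqrt L"]) auto
    then have "\<bar>\<psi> x - \<psi> y\<bar> \<le> gamma b c x y"
      unfolding gamma_def by (rule cSUP_upper[OF \<psi>])
    then have "\<bar>\<psi> x\<bar> \<le> K"
      using K[of x y] y by simp
    then have "(\<psi> x)\<^sup>2 \<le> K\<^sup>2"
      by (metis abs_ge_zero power2_abs power_mono)
    then show ?thesis
      using \<phi>(2) by (simp add: \<psi>_def power_mult_distrib power_divide field_simps)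
  qed
  then show "\<exists>C. sup_bounded b c C"
    unfolding sup_bounded_def by blast
next
  assume "\<exists>C. sup_bounded b c C"
  then obtain C where C: "sup_bounded b c C" ..
  have "gamma b c x y \<le> 2 * sqrt C" for x y
    unfolding gamma_def
  proof (rule cSUP_least)
    have "(\<lambda>x. 0) \<in> {\<phi> \<in> C_c. energy b c \<phi> \<le> 1}"
      by (simp add: energy_zero C_c_zero)
    then show "{\<phi> \<in> C_c. energy b c \<phi> \<le> 1} \<noteq> {}"
      by blast
    fix \<phi>
    assume "\<phi> \<in> {\<phi> \<in> C_c. energy b c \<phi> \<le> 1}"
    then have "\<bar>\<phi> z\<bar> \<le> sqrt C" for z
      using sup_boundedD[OF C, of \<phi> 1 z] by (intro real_le_rsqrt) simp
    from this[of x] this[of y] show "\<bar>\<phi> x - \<phi> y\<bar> \<le> 2 * sqrt C"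
      by linarith
  qed
  then show "finite_diameter (gamma b c)"
    unfolding finite_diameter_def by blast
qed

text \<open>
  Finitely supported functions normalized at \<open>v\<close> cannot have arbitrarily small energy: compared with
  a first such function, whose support misses some \<open>x\<close>, a second one of tiny energy would be close
  to \<open>1\<close> at \<open>x\<close> by connectedness, yet uniformly close to the first one.
\<close>

lemma killed_sup_bounded_imp_capacity_pos:
  assumes "infinite (UNIV :: 'a set)" and "sup_bounded b (c(v := c v + 1)) C"
  obtains \<delta> where "0 < \<delta>"
    and "\<And>\<psi>. \<psi> \<in> C_c \<Longrightarrow> \<psi> v = 1 \<Longrightarrow> \<not> energy b c \<psi> \<le> ennreal \<delta>"
proof -
  \<comment> \<open>A positive constant is needed, since \<open>s\<close> is obtained by dividing by
    it.\<close>
  define D where "D = max C 1"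
  have D: "1 \<le> D" "sup_bounded b (c(v := c v + 1)) D"
    using sup_bounded_mono[OF assms(2)] by (auto simp: D_def)
  have "\<exists>\<delta>>0. \<forall>\<psi>\<in>C_c. \<psi> v = 1 \<longrightarrow> \<not> energy b c \<psi> \<le> ennreal \<delta>"
  proof (rule ccontr)
    assume "\<not> ?thesis"
    then have small: "\<exists>\<psi>\<in>C_c. \<psi> v = 1 \<and> energy b c \<psi> \<le> ennreal \<delta>" if "0 < \<delta>" for \<delta>
      using that by blast
    \<comment> \<open>The difference of the two functions will have energy at most
      \<open>4 * s\<close>, hence modulus at most 1/2 everywhere.\<close>
    define s where "s = 1 / (16 * D)"
    have s: "0 < s" "D * (4 * s) = 1 / 4"
      using D(1) by (auto simp: s_def)
    obtain \<psi>1 where \<psi>1: "\<psi>1 \<in> C_c" "\<psi>1 v = 1" "energy b c \<psi>1 \<le> ennreal s"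
      using small[OF s(1)] by blast
    obtain x where x: "\<psi>1 x = 0"
      using C_c_vanishes_somewhere[OF assms(1) \<psi>1(1)] by blast
    obtain K where K: "0 \<le> K"
        "\<And>f s. 0 \<le> s \<Longrightarrow> energy b c f \<le> ennreal s \<Longrightarrow> (f x - f v)\<^sup>2 \<le> K * s"
      using energy_controls_difference by blast
    \<comment> \<open>The second bound puts \<psi>2 at \<open>x\<close> within less than 1/2 of its
      value 1 at \<open>v\<close>; \<open>K + 1\<close> keeps the denominator positive when
      \<open>K\<close> is 0.\<close>
    define t where "t = min s (1 / (16 * (K + 1)))"
    have t: "0 < t" "t \<le> s" "K * t < 1 / 4"
    proof -
      show "0 < t" "t \<le> s"
        using s(1) K(1) by (auto simp: t_def)
      have "K * t \<le> K * (1 / (16 * (K + 1)))"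
        using K(1) by (intro mult_left_mono) (auto simp: t_def)
      also have "\<dots> < 1 / 4"
        using K(1) by (simp add: field_simps)
      finally show "K * t < 1 / 4" .
    qed
    obtain \<psi>2 where \<psi>2: "\<psi>2 \<in> C_c" "\<psi>2 v = 1" "energy b c \<psi>2 \<le> ennreal t"
      using small[OF t(1)] by blast
    have "energy b c (\<lambda>z. \<psi>2 z - \<psi>1 z) \<le> ennreal (2 * t + 2 * s)"
      using energy_diff_le[OF \<psi>2(3) \<psi>1(3)] s(1) t(1) by simp
    also have "\<dots> \<le> ennreal (4 * s)"
      using t(2) by (intro ennreal_leI) simp
    \<comment> \<open>Both functions equal 1 at \<open>v\<close>, so their difference vanishes there
      and killing adds no energy.\<close>
    finally have "energy b (c(v := c v + 1)) (\<lambda>z. \<psi>2 z - \<psi>1 z) \<le> ennreal (4 * s)"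
      by (simp add: energy_killed \<psi>1(2) \<psi>2(2))
    from sup_boundedD[OF D(2) C_c_diff[OF \<psi>2(1) \<psi>1(1)] _ this, of x]
    have "(\<psi>2 x)\<^sup>2 \<le> (1 / 2)\<^sup>2"
      using s x by (simp add: power_divide)
    then have "\<bar>\<psi>2 x\<bar> \<le> 1 / 2"
      by (simp only: abs_le_square_iff[symmetric])
    moreover have "(\<psi>2 x - 1)\<^sup>2 < (1 / 2)\<^sup>2"
      using K(2)[OF _ \<psi>2(3)] \<psi>2(2) t by (simp add: power_divide)
    then have "\<bar>\<psi>2 x - 1\<bar> < 1 / 2"
      using abs_le_square_iff[of "1 / 2" "\<psi>2 x - 1"] by linarith
    ultimately show False
      by linarith
  qed
  with that show ?thesis
    by blast
qed

text \<open>Killing only increases the energy, which gives one direction. For the other, the lower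
  bound \<delta> for functions normalized at \<open>v\<close> yields
  \<open>(\<phi> v)\<^sup>2 \<le> s / \<delta>\<close> by scaling, so the killed energy is at most a
  constant multiple of \<open>s\<close>.\<close>

lemma sup_bounded_killed_iff:
  assumes "infinite (UNIV :: 'a set)"
  shows "(\<exists>C. sup_bounded b (c(v := c v + 1)) C) \<longleftrightarrow> (\<exists>C. sup_bounded b c C)"
proof
  assume "\<exists>C. sup_bounded b c C"
  then obtain C where "sup_bounded b c C" ..
  then have "sup_bounded b (c(v := c v + 1)) C"
    unfolding sup_bounded_def using killed_energy_le(1)[OF _ less_imp_le] by blast
  then show "\<exists>C. sup_bounded b (c(v := c v + 1)) C" ..
next
  assume "\<exists>C. sup_bounded b (c(v := c v + 1)) C"
  then obtain C where C: "sup_bounded b (c(v := c v + 1)) C" ..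
  obtain \<delta> where \<delta>: "0 < \<delta>"
      "\<And>\<psi>. \<psi> \<in> C_c \<Longrightarrow> \<psi> v = 1 \<Longrightarrow> \<not> energy b c \<psi> \<le> ennreal \<delta>"
    using killed_sup_bounded_imp_capacity_pos[OF assms C] by blast
  have "(\<phi> x)\<^sup>2 \<le> C * (1 + 1 / \<delta>) * s"
    if \<phi>: "\<phi> \<in> C_c" "0 < s" "energy b c \<phi> \<le> ennreal s" for \<phi> s x
  proof -
    have "(\<phi> v)\<^sup>2 \<le> s / \<delta>"
    proof (rule ccontr)
      assume "\<not> ?thesis"
      then have large: "s / \<delta> < (\<phi> v)\<^sup>2"
        by simp
      then have "\<phi> v \<noteq> 0"
        using \<phi>(2) \<delta>(1) by (auto simp: divide_less_0_iff)
      have "energy b c (\<lambda>x. 1 / \<phi> v * \<phi> x) \<le> ennreal ((1 / \<phi> v)\<^sup>2 * s)"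
        using \<phi>(2) by (intro energy_scale_le \<phi>(3)) simp
      also have "\<dots> \<le> ennreal \<delta>"
        using large \<delta>(1) \<open>\<phi> v \<noteq> 0\<close> by (intro ennreal_leI) (simp add: field_simps)
      finally have "energy b c (\<lambda>x. 1 / \<phi> v * \<phi> x) \<le> ennreal \<delta>" .
      with \<delta>(2)[of "\<lambda>x. 1 / \<phi> v * \<phi> x"] C_c_comp[OF \<phi>(1), of "\<lambda>u. 1 / \<phi> v * u"] \<open>\<phi> v \<noteq> 0\<close>
      show False
        by simp
    qed
    with \<phi>(3) have "energy b (c(v := c v + 1)) \<phi> \<le> ennreal s + ennreal (s / \<delta>)"
      unfolding energy_killed by (intro add_mono ennreal_leI)
    also have "\<dots> = ennreal (s + s / \<delta>)"
      using \<phi>(2) \<delta>(1) by simp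
    finally show ?thesis
      using sup_boundedD[OF C \<phi>(1), of "s + s / \<delta>" x] \<phi>(2) \<delta>(1)
      by (simp add: algebra_simps add_pos_pos)
  qed
  then show "\<exists>C. sup_bounded b c C"
    unfolding sup_bounded_def by blast
qed

section \<open>Uniform transience\<close>

text \<open>The inequality covers only finitely supported functions, so it cannot be applied to
  \<open>f - \<phi>\<close>. At each \<open>x\<close> a better approximant \<psi> is inserted:
  \<phi> and \<psi> are compared by the inequality, \<psi> and \<open>f\<close> by continuity of
  evaluation at \<open>x\<close>.\<close>

lemma sup_bounded_imp_finite_energy_0_subset:
  assumes "sup_bounded b (c(v := c v + 1)) C"
  shows "finite_energy_0 b c v \<subseteq> C_0"
proof
  interpret killed: connected_weighted_graph b "c(v := c v + 1)"
    by (rule connected_weighted_graph_killed)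
  let ?E = "energy b (c(v := c v + 1))"
  define D where "D = max C 1"
  have D: "1 \<le> D" "sup_bounded b (c(v := c v + 1)) D"
    using sup_bounded_mono[OF assms] by (auto simp: D_def)
  fix f
  assume f: "f \<in> finite_energy_0 b c v"
  then have approx: "\<exists>\<phi>\<in>C_c. ?E (\<lambda>x. f x - \<phi> x) \<le> ennreal s" if "0 < s" for s
    using that by (simp add: mem_finite_energy_0_iff)
  have "\<exists>\<phi>\<in>C_c. sup_norm (\<lambda>x. f x - \<phi> x) < ennreal \<epsilon>" if "0 < \<epsilon>" for \<epsilon>
  proof -
    define s where "s = \<epsilon>\<^sup>2 / (64 * D)"
    have s: "0 < s" "D * (4 * s) = (\<epsilon> / 4)\<^sup>2"
      using D(1) \<open>0 < \<epsilon>\<close> by (auto simp: s_def field_simps power2_eq_square)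
    obtain \<phi> where \<phi>: "\<phi> \<in> C_c" "?E (\<lambda>x. f x - \<phi> x) \<le> ennreal s"
      using approx[OF s(1)] by blast
    have "\<bar>f x - \<phi> x\<bar> \<le> \<epsilon> / 2" for x
    proof -
      obtain K where K: "0 < K" "\<And>f s. 0 \<le> s \<Longrightarrow> ?E f \<le> ennreal s \<Longrightarrow> (f x)\<^sup>2 \<le> K * s"
        using killed_energy_controls_value by blast
      \<comment> \<open>\<open>t\<close> and \<psi> may depend on \<open>x\<close>; uniformity
        survives because \<phi> was fixed before \<open>x\<close>, and the bound for
        \<open>\<phi> - \<psi>\<close> uses only \<open>t \<le> s\<close>.\<close>
      define t where "t = min s ((\<epsilon> / 4)\<^sup>2 / K)"
      have t: "0 < t" "t \<le> s" "K * t \<le> (\<epsilon> / 4)\<^sup>2"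
        using s(1) K(1) \<open>0 < \<epsilon>\<close> by (auto simp: t_def min_def field_simps)
      obtain \<psi> where \<psi>: "\<psi> \<in> C_c" "?E (\<lambda>x. f x - \<psi> x) \<le> ennreal t"
        using approx[OF t(1)] by blast
      have "?E (\<lambda>x. (f x - \<psi> x) - (f x - \<phi> x)) \<le> ennreal (2 * t + 2 * s)"
        using killed.energy_diff_le[OF \<psi>(2) \<phi>(2)] s(1) t(1) by simp
      also have "\<dots> \<le> ennreal (4 * s)"
        using t(2) by (intro ennreal_leI) simp
      finally have "?E (\<lambda>x. \<phi> x - \<psi> x) \<le> ennreal (4 * s)"
        by simp
      from sup_boundedD[OF D(2) C_c_diff[OF \<phi>(1) \<psi>(1)] _ this, of x]
      have "(\<phi> x - \<psi> x)\<^sup>2 \<le> (\<epsilon> / 4)\<^sup>2"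
        using s by simp
      then have "\<bar>\<phi> x - \<psi> x\<bar> \<le> \<epsilon> / 4"
        using \<open>0 < \<epsilon>\<close> by (simp add: abs_le_square_iff[symmetric])
      moreover have "(f x - \<psi> x)\<^sup>2 \<le> (\<epsilon> / 4)\<^sup>2"
        using K(2)[OF _ \<psi>(2)] t by simp
      then have "\<bar>f x - \<psi> x\<bar> \<le> \<epsilon> / 4"
        using \<open>0 < \<epsilon>\<close> by (simp add: abs_le_square_iff[symmetric])
      ultimately show ?thesis
        by linarith
    qed
    then have "sup_norm (\<lambda>x. f x - \<phi> x) \<le> ennreal (\<epsilon> / 2)"
      unfolding sup_norm_def by (intro SUP_least ennreal_leI)
    also have "\<dots> < ennreal \<epsilon>"
      using \<open>0 < \<epsilon>\<close> by (simp add: ennreal_lessI)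
    finally show ?thesis
      using \<phi>(1) by blast
  qed
  then show "f \<in> C_0"
    by (simp add: C_0_def)
qed

text \<open>A function violating the inequality for a large constant is scaled to 1 at the violating
  vertex, and its modulus is taken. That vertex avoids \<open>F\<close> because evaluations at the
  finitely many points of \<open>F\<close> obey a common bound.\<close>

lemma exists_bump_off_finite_set:
  assumes "\<not> (\<exists>C. sup_bounded b (c(v := c v + 1)) C)" and "finite F" and "0 < \<eta>"
  obtains \<phi> x where "\<phi> \<in> C_c" "x \<notin> F" "\<And>y. 0 \<le> \<phi> y" "\<phi> x = 1"
    "energy b (c(v := c v + 1)) \<phi> \<le> ennreal \<eta>"
proof -
  interpret killed: connected_weighted_graph b "c(v := c v + 1)"
    by (rule connected_weighted_graph_killed)
  let ?E = "energy b (c(v := c v + 1))"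
  have "\<forall>x. \<exists>K>0. \<forall>f s. 0 \<le> s \<longrightarrow> ?E f \<le> ennreal s \<longrightarrow> (f x)\<^sup>2 \<le> K * s"
    using killed_energy_controls_value by metis
  then obtain K where K: "\<And>x. 0 < K x"
      "\<And>x f s. 0 \<le> s \<Longrightarrow> ?E f \<le> ennreal s \<Longrightarrow> (f x)\<^sup>2 \<le> K x * s"
    by metis
  \<comment> \<open>The first summand makes the scaled energy at most \<eta>; the second dominates
    \<open>K x\<close> for every \<open>x\<close> in \<open>F\<close>, so no violation can occur
    there.\<close>
  define C where "C = 1 / \<eta> + sum K F"
  have C: "1 / \<eta> \<le> C"
    using K(1) by (simp add: C_def sum_nonneg less_imp_le)
  obtain \<phi> s x where \<phi>: "\<phi> \<in> C_c" "0 < s" "?E \<phi> \<le> ennreal s" "C * s < (\<phi> x)\<^sup>2"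
    using assms(1) unfolding sup_bounded_def not_ex by (auto simp: not_le dest: spec[of _ C])
  have "0 < C"
    using assms(3) by (intro less_le_trans[OF _ C]) simp
  then have "\<phi> x \<noteq> 0"
    using \<phi>(4) mult_pos_pos[OF _ \<phi>(2), of C] by auto
  have "x \<notin> F"
  proof
    assume "x \<in> F"
    then have "K x \<le> sum K F"
      using assms(2) K(1) by (simp add: member_le_sum less_imp_le)
    moreover have "0 < 1 / \<eta>"
      using assms(3) by simp
    ultimately have "K x \<le> C"
      unfolding C_def by linarith
    then have "(\<phi> x)\<^sup>2 \<le> C * s"
      using K(2)[OF _ \<phi>(3), of x] \<phi>(2) mult_right_mono[of "K x" C s] by linarith
    with \<phi>(4) show False
      by simp
  qed
  moreover have "(\<lambda>y. \<bar>1 / \<phi> x * \<phi> y\<bar>) \<in> C_c"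
    using C_c_comp[OF \<phi>(1), of "\<lambda>u. \<bar>1 / \<phi> x * u\<bar>"] by simp
  moreover have "?E (\<lambda>y. \<bar>1 / \<phi> x * \<phi> y\<bar>) \<le> ennreal \<eta>"
  proof -
    have "?E (\<lambda>y. \<bar>1 / \<phi> x * \<phi> y\<bar>) \<le> ennreal ((1 / \<phi> x)\<^sup>2 * s)"
      using \<phi>(2) by (intro killed.energy_abs_le killed.energy_scale_le \<phi>(3)) auto
    also have "s \<le> \<eta> * (\<phi> x)\<^sup>2"
    proof -
      have "1 / \<eta> * s \<le> C * s"
        using C \<phi>(2) by (intro mult_right_mono) auto
      then have "1 / \<eta> * s \<le> (\<phi> x)\<^sup>2"
        using \<phi>(4) by linarith
      then show ?thesis
        using assms(3) by (simp add: field_simps)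
    qed
    then have "ennreal ((1 / \<phi> x)\<^sup>2 * s) \<le> ennreal \<eta>"
      using \<open>\<phi> x \<noteq> 0\<close> by (intro ennreal_leI) (simp add: field_simps power_divide)
    finally show ?thesis .
  qed
  ultimately show ?thesis
    using that[of "\<lambda>y. \<bar>1 / \<phi> x * \<phi> y\<bar>" x] \<open>\<phi> x \<noteq> 0\<close> by simp
qed

lemma energy_sum_geometric_le:
  assumes "\<And>k. energy b c (\<phi> k) \<le> ennreal ((1 / 4) ^ k)"
  shows "energy b c (\<lambda>x. \<Sum>k<m. \<phi> (k + n) x) \<le> ennreal (4 * (1 / 4) ^ n)"
proof (induction m arbitrary: n)
  case 0
  then show ?case
    by (simp add: energy_zero)
next
  case (Suc m)
  have "(\<Sum>k<Suc m. \<phi> (k + n) x) = \<phi> n x + (\<Sum>k<m. \<phi> (k + Suc n) x)" for x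
    by (simp add: sum.lessThan_Suc_shift del: sum.lessThan_Suc)
  \<comment> \<open>The ratio 1/4 absorbs the doubling: the right-hand side equals
    \<open>4 * (1 / 4) ^ n\<close>.\<close>
  moreover have "energy b c (\<lambda>x. \<phi> n x + (\<Sum>k<m. \<phi> (k + Suc n) x))
      \<le> ennreal (2 * (1 / 4) ^ n + 2 * (4 * (1 / 4) ^ Suc n))"
    by (intro energy_add_le assms Suc.IH) auto
  ultimately show ?case
    by simp
qed

lemma not_sup_bounded_imp_not_finite_energy_0_subset:
  assumes "countable (UNIV :: 'a set)" and "infinite (UNIV :: 'a set)"
    and "\<not> (\<exists>C. sup_bounded b (c(v := c v + 1)) C)"
  shows "\<not> finite_energy_0 b c v \<subseteq> C_0"
proof -
  interpret killed: connected_weighted_graph b "c(v := c v + 1)"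
    by (rule connected_weighted_graph_killed)
  let ?E = "energy b (c(v := c v + 1))"
  \<comment> \<open>An exhaustion of the vertex set by finite sets; peaks outside \<open>F n\<close>
    leave every finite set.\<close>
  define F where "F n = from_nat_into (UNIV :: 'a set) ` {..<n}" for n
  have "\<exists>\<phi> x. \<phi> \<in> C_c \<and> x \<notin> F n \<and> (\<forall>y. 0 \<le> \<phi> y) \<and> \<phi> x = 1 \<and> ?E \<phi> \<le> ennreal ((1 / 4) ^ n)" for n
    by (rule exists_bump_off_finite_set[OF assms(3), of "F n" "(1 / 4) ^ n"]) (auto simp: F_def)
  then obtain \<phi> p where \<phi>: "\<And>n. \<phi> n \<in> C_c" "\<And>n. p n \<notin> F n" "\<And>n y. 0 \<le> \<phi> n y"
      "\<And>n. \<phi> n (p n) = 1" "\<And>n. ?E (\<phi> n) \<le> ennreal ((1 / 4) ^ n)"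
    by metis
  have summable: "summable (\<lambda>n. \<phi> n x)" for x
  proof -
    obtain K where K: "0 < K" "\<And>f s. 0 \<le> s \<Longrightarrow> ?E f \<le> ennreal s \<Longrightarrow> (f x)\<^sup>2 \<le> K * s"
      using killed_energy_controls_value by blast
    have "\<bar>\<phi> n x\<bar> \<le> sqrt K * (1 / 2) ^ n" for n
    proof -
      have "(\<phi> n x)\<^sup>2 \<le> K * (1 / 4) ^ n"
        using K(2)[OF _ \<phi>(5)] by simp
      also have "(1 / 4 :: real) ^ n = ((1 / 2) ^ n)\<^sup>2"
        by (simp add: power2_eq_square flip: power_mult_distrib)
      finally show ?thesis
        using K(1) real_le_rsqrt[of "\<bar>\<phi> n x\<bar>" "K * ((1 / 2) ^ n)\<^sup>2"] by (simp add: real_sqrt_mult)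
    qed
    moreover have "summable (\<lambda>n. sqrt K * (1 / 2) ^ n)"
      by (intro summable_mult summable_geometric) simp
    ultimately show ?thesis
      using summable_comparison_test'[of "\<lambda>n. sqrt K * (1 / 2) ^ n" 0 "\<lambda>n. \<phi> n x"] by simp
  qed
  define f where "f x = (\<Sum>n. \<phi> n x)" for x
  \<comment> \<open>The finite sums of the tail converge pointwise and have uniformly bounded
    energy, so lower semicontinuity applies.\<close>
  have tail: "?E (\<lambda>x. f x - (\<Sum>k<n. \<phi> k x)) \<le> ennreal (4 * (1 / 4) ^ n)" for n
  proof (rule killed.energy_lower_semicontinuous)
    fix x
    have "(\<lambda>k. \<phi> (k + n) x) sums (\<Sum>k. \<phi> (k + n) x)"
      by (intro summable_sums summable_ignore_initial_segment summable)
    then show "(\<lambda>m. \<Sum>k<m. \<phi> (k + n) x) \<longlonglongrightarrow> f x - (\<Sum>k<n. \<phi> k x)"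
      by (simp add: sums_def f_def suminf_minus_initial_segment[OF summable])
  qed (auto intro: killed.energy_sum_geometric_le \<phi>(5))
  have "f \<in> finite_energy_0 b c v"
    unfolding mem_finite_energy_0_iff
  proof (intro conjI allI impI)
    have "?E f \<le> ennreal 4"
      using tail[of 0] by simp
    then have "energy b c f \<le> ennreal 4"
      by (rule killed_energy_le(1)) simp
    then show "energy b c f < \<infinity>"
      by (metis ennreal_less_top infinity_ennreal_def order_le_less_trans)
    fix s :: real
    assume "0 < s"
    then obtain n where "(1 / 4) ^ n < s / 4"
      using real_arch_pow_inv[of "s / 4" "1 / 4"] by auto
    then have "ennreal (4 * (1 / 4) ^ n) \<le> ennreal s"
      by (intro ennreal_leI) linarith
    with tail[of n] have "?E (\<lambda>x. f x - (\<Sum>k<n. \<phi> k x)) \<le> ennreal s"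
      by (rule order_trans)
    moreover have "(\<lambda>x. \<Sum>k<n. \<phi> k x) \<in> C_c"
      by (intro C_c_sum \<phi>(1))
    ultimately show "\<exists>\<phi>\<in>C_c. ?E (\<lambda>x. f x - \<phi> x) \<le> ennreal s"
      by (intro bexI[of _ "\<lambda>x. \<Sum>k<n. \<phi> k x"])
  qed
  moreover have "f \<notin> C_0"
  proof
    assume "f \<in> C_0"
    then obtain \<psi> where \<psi>: "\<psi> \<in> C_c" "sup_norm (\<lambda>x. f x - \<psi> x) < ennreal 1"
      unfolding C_0_def using zero_less_one by blast
    have fin: "finite {x. \<psi> x \<noteq> 0}"
      using \<psi>(1) by (simp add: C_c_def)
    \<comment> \<open>Beyond every index occurring in the support of \<psi>; inserting 0 keeps
      \<open>Max\<close> meaningful when the support is empty.\<close>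
    define n where "n = Suc (Max (insert 0 (to_nat_on (UNIV :: 'a set) ` {x. \<psi> x \<noteq> 0})))"
    have "{x. \<psi> x \<noteq> 0} \<subseteq> F n"
    proof
      fix x
      assume "x \<in> {x. \<psi> x \<noteq> 0}"
      then have "to_nat_on (UNIV :: 'a set) x < n"
        unfolding n_def using fin by (intro le_imp_less_Suc Max_ge) auto
      moreover have "x = from_nat_into UNIV (to_nat_on (UNIV :: 'a set) x)"
        using assms(1) by simp
      ultimately show "x \<in> F n"
        unfolding F_def by blast
    qed
    then have "\<psi> (p n) = 0"
      using \<phi>(2)[of n] by auto
    \<comment> \<open>Nonnegative bumps cannot cancel, so the single term of index \<open>n\<close>
      already gives this.\<close>
    moreover have "1 \<le> f (p n)"
      using sum_le_suminf[OF summable, of "{n}" "p n"] \<phi>(3,4) by (simp add: f_def)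
    ultimately have "ennreal 1 \<le> ennreal \<bar>f (p n) - \<psi> (p n)\<bar>"
      by (intro ennreal_leI) simp
    also have "\<dots> \<le> sup_norm (\<lambda>x. f x - \<psi> x)"
      unfolding sup_norm_def by (rule SUP_upper) simp
    finally show False
      using \<psi>(2) by simp
  qed
  ultimately show ?thesis
    by blast
qed

end

theorem theorem3p2:
  fixes b :: "'a \<Rightarrow> 'a \<Rightarrow> real" and c :: "'a \<Rightarrow> real"
  assumes "countable (UNIV :: 'a set)" and "infinite (UNIV :: 'a set)"
    and "connected_weighted_graph b c"
  shows "(uniformly_transient b c \<longleftrightarrow> (\<exists>v. finite_diameter (gamma_pt b c v)))
    \<and> ((\<exists>v. finite_diameter (gamma_pt b c v)) \<longleftrightarrow> (\<forall>v. finite_diameter (gamma_pt b c v)))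
    \<and> (uniformly_transient b c \<longleftrightarrow> finite_diameter (gamma b c))"
proof -
  interpret connected_weighted_graph b c
    by (rule assms(3))
  let ?P = "\<exists>C. sup_bounded b c C"
  \<comment> \<open>The diameter criterion is applied to the killed graph, and the killing is then
    removed. \<open>?P\<close> does not mention \<open>v\<close>, whence independence of the base
    point.\<close>
  have "finite_diameter (gamma_pt b c v) \<longleftrightarrow> ?P" for v
    using connected_weighted_graph.finite_diameter_gamma_iff[OF connected_weighted_graph_killed assms(2)]
      sup_bounded_killed_iff[OF assms(2)]
    by (simp only: gamma_pt_eq_gamma)
  moreover have "finite_diameter (gamma b c) \<longleftrightarrow> ?P"
    by (rule finite_diameter_gamma_iff[OF assms(2)])
  moreover have "finite_energy_0 b c v \<subseteq> C_0 \<longleftrightarrow> ?P" for v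
    using sup_bounded_imp_finite_energy_0_subset[of v]
      not_sup_bounded_imp_not_finite_energy_0_subset[OF assms(1,2), of v]
      sup_bounded_killed_iff[OF assms(2), of v]
    by blast
  then have "uniformly_transient b c \<longleftrightarrow> ?P"
    using assms(3) by (auto simp: uniformly_transient_def)
  ultimately show ?thesis
    by blast
qed

end
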